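(* Let $m\ge 2$ be an integer, let $\alpha_0,\dots,\alpha_{m-1}$ be nonnegative reals with $\sum_{i=0}^{m-1}\alpha_i=1$, and suppose the Basic Hypothesis (see context) holds. Let $\mathbf T=\mathbf T_m\mathbf T_{m-1}\cdots\mathbf T_1\in\mathbb R^{m\times m}$. Then $$\lim_{n\to\infty}\mathbf T^n=\frac{\mathbf e\,\mathbf a^{*}}{\mathbf a^{*}\mathbf e}=\mathbf e\,\boldsymbol\lambda^{*},$$ i.e. the limit exists and is the matrix all of whose rows equal $$\frac{1}{\sum_{k=0}^{m-1}\sum_{i=0}^{k}\alpha_i}\Big(\alpha_0,\ \sum_{i=0}^{1}\alpha_i,\ \dots,\ \sum_{i=0}^{m-2}\alpha_i,\ 1\Big).$$ Moreover, $$\operatorname{Fix}\mathbf T=\mathbf D=\operatorname{Fix}\mathbf T_1\cap\cdots\cap\operatorname{Fix}\mathbf T_m .$$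
   Context: Notation: ${}^*$ denotes (conjugate) transpose; $\operatorname{Fix}\mathbf B=\{x\in\mathbb R^m : \mathbf Bx=x\}$; $\mathbf D=\{(x,x,\dots,x)\in\mathbb R^m : x\in\mathbb R\}$ is the diagonal; $\mathbf e=(1,\dots,1)^*\in\mathbb R^m$. For $k\in\{0,\dots,m-1\}$ set $a_k=\sum_{i=0}^k\alpha_i$, $\mathbf a=(a_0,\dots,a_{m-1})^*$, $\lambda_k=a_k/\sum_{i=0}^{m-1}a_i$, and $\boldsymbol\lambda=(\lambda_0,\dots,\lambda_{m-1})^*$. Basic Hypothesis: the polynomial $p(x)=x^m-\alpha_{m-1}x^{m-1}-\cdots-\alpha_1x-\alpha_0$ has a unique positive root, which is simple and equal to $1$, and every other (complex) root has modulus strictly less than $1$. For $k\in\{1,\dots,m\}$, the matrix $\mathbf T_k\in\mathbb R^{m\times m}$ is defined entrywise (rows and columns indexed $1,\dots,m$) by $$(\mathbf T_k)_{i,j}=\begin{cases}\alpha_{m-k+j},&\text{if } i=k \text{ and } 1\le j<k;\\ \alpha_{j-k},&\text{if } i=k\text{ and } k\le j\le m;\\ 1,&\text{if } i\ne k\text{ and } j=i;\\ 0,&\text{otherwise.}\end{cases}$$ *)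

theory Defs
  imports
    Complex_Main
    "HOL-Computational_Algebra.Polynomial"
    "Jordan_Normal_Form.Matrix"
begin

text \<open>The coefficients are given as a function \<open>\<alpha> :: nat \<Rightarrow> real\<close>, of which only the values
  \<open>\<alpha> 0, \<dots>, \<alpha> (m - 1)\<close> are ever used.\<close>

definition char_p :: "nat \<Rightarrow> (nat \<Rightarrow> real) \<Rightarrow> real poly" where
  "char_p m \<alpha> = monom 1 m - (\<Sum>i<m. monom (\<alpha> i) i)"

definition basic_hypothesis :: "nat \<Rightarrow> (nat \<Rightarrow> real) \<Rightarrow> bool" where
  "basic_hypothesis m \<alpha> \<longleftrightarrow>
     (\<forall>x>0. poly (char_p m \<alpha>) x = 0 \<longleftrightarrow> x = 1) \<and>
     order 1 (char_p m \<alpha>) = 1 \<and>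
     (\<forall>z::complex. poly (map_poly complex_of_real (char_p m \<alpha>)) z = 0 \<and> z \<noteq> 1 \<longrightarrow> norm z < 1)"

text \<open>Matrices in \<^theory>\<open>Jordan_Normal_Form.Matrix\<close> are indexed from 0, whereas \<open>k\<close> and the entry
  formula below use indices \<open>1, \<dots>, m\<close>; hence the shift by \<open>Suc\<close>.\<close>

definition T_entry :: "nat \<Rightarrow> (nat \<Rightarrow> real) \<Rightarrow> nat \<Rightarrow> nat \<Rightarrow> nat \<Rightarrow> real" where
  "T_entry m \<alpha> k i j =
     (if i = k \<and> 1 \<le> j \<and> j < k then \<alpha> (m - k + j)
      else if i = k \<and> k \<le> j \<and> j \<le> m then \<alpha> (j - k)
      else if i \<noteq> k \<and> j = i then 1
      else 0)"

definition T_mat :: "nat \<Rightarrow> (nat \<Rightarrow> real) \<Rightarrow> nat \<Rightarrow> real mat" where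
  "T_mat m \<alpha> k = mat m m (\<lambda>(i, j). T_entry m \<alpha> k (Suc i) (Suc j))"

text \<open>\<open>T_prod m \<alpha> k\<close> is the product \<open>T\<^sub>k \<cdots> T\<^sub>1\<close>, with the factor of largest index leftmost.\<close>

fun T_prod :: "nat \<Rightarrow> (nat \<Rightarrow> real) \<Rightarrow> nat \<Rightarrow> real mat" where
  "T_prod m \<alpha> 0 = 1\<^sub>m m"
| "T_prod m \<alpha> (Suc k) = T_mat m \<alpha> (Suc k) * T_prod m \<alpha> k"

definition T_full :: "nat \<Rightarrow> (nat \<Rightarrow> real) \<Rightarrow> real mat" where
  "T_full m \<alpha> = T_prod m \<alpha> m"

definition Fix :: "nat \<Rightarrow> real mat \<Rightarrow> real vec set" where
  "Fix m B = {x \<in> carrier_vec m. B *\<^sub>v x = x}"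

definition diagonal :: "nat \<Rightarrow> real vec set" where
  "diagonal m = {vec m (\<lambda>_. x) |x. True}"

definition e_vec :: "nat \<Rightarrow> real vec" where
  "e_vec m = vec m (\<lambda>_. 1)"

definition a_coeff :: "(nat \<Rightarrow> real) \<Rightarrow> nat \<Rightarrow> real" where
  "a_coeff \<alpha> k = (\<Sum>i\<le>k. \<alpha> i)"

definition a_vec :: "nat \<Rightarrow> (nat \<Rightarrow> real) \<Rightarrow> real vec" where
  "a_vec m \<alpha> = vec m (a_coeff \<alpha>)"

definition lambda_vec :: "nat \<Rightarrow> (nat \<Rightarrow> real) \<Rightarrow> real vec" where
  "lambda_vec m \<alpha> = vec m (\<lambda>k. a_coeff \<alpha> k / (\<Sum>i<m. a_coeff \<alpha> i))"

text \<open>The rank-one matrix \<open>v w\<^sup>*\<close>: a column times a row.\<close>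

definition outer_prod :: "real vec \<Rightarrow> real vec \<Rightarrow> real mat" where
  "outer_prod v w = mat_of_cols (dim_vec v) [v] * mat_of_rows (dim_vec w) [w]"

text \<open>The type of matrices of varying dimension carries no topology. Convergence in the
  finite-dimensional space of \<open>r \<times> c\<close> real matrices is entrywise convergence.\<close>

definition mat_tendsto :: "(nat \<Rightarrow> real mat) \<Rightarrow> real mat \<Rightarrow> bool" where
  "mat_tendsto X L \<longleftrightarrow>
     (\<forall>n. X n \<in> carrier_mat (dim_row L) (dim_col L)) \<and>
     (\<forall>i<dim_row L. \<forall>j<dim_col L. (\<lambda>n. X n $$ (i, j)) \<longlonglongrightarrow> L $$ (i, j))"

end

theory Submission
  imports Defs "HOL-Computational_Algebra.Fundamental_Theorem_Algebra"
begin

text \<open>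
  Let \<open>s\<close> be the solution of \<open>s (n + m) = (\<Sum>i<m. \<alpha> i * s (n + i))\<close> whose first \<open>m\<close> terms are the
  entries of a vector \<open>x\<close>. The matrix \<open>T\<^sub>k\<close> overwrites the \<open>k\<close>-th entry of a window of \<open>m\<close>
  consecutive terms, so that applying \<open>T\<^sub>1, \<dots>, T\<^sub>m\<close> in turn replaces every term by the one that comes
  \<open>m\<close> places later. Hence \<open>T\<^sup>n x\<close> is the window of \<open>s\<close> that starts at \<open>n * m\<close>
  (\<open>T_full_power_window\<close>), and the theorem says that every solution \<open>s\<close> converges to
  \<open>(\<Sum>k<m. \<lambda>\<^sub>k * s k)\<close>.

  The polynomial of the recurrence factors as \<open>p(x) = (x - 1) q(x)\<close>, where \<open>q(x) = (\<Sum>k<m. a\<^sub>k x^k)\<close>.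
  For the recurrence this means that \<open>\<Sum>k<m. a\<^sub>k * s (n + k)\<close> does not depend on \<open>n\<close>; both
  facts are the summation by parts in \<open>summation_by_parts_partial_sums\<close>. Subtracting the right
  constant from \<open>s\<close> therefore gives a solution of the recurrence with polynomial \<open>q\<close>. Since \<open>q(1) > 0\<close>,
  the roots of \<open>q\<close> are roots of \<open>p\<close> other than 1 and lie in the open unit disc, and for such a
  polynomial all solutions tend to 0 (\<open>stable_recurrence_tendsto_0\<close>): peel off one linear factor at a
  time, each of which amounts to a contraction with a vanishing perturbation.

  The fixed points come from the limit. If \<open>T x = x\<close>, then \<open>x = lim T\<^sup>n x\<close> is constant.
  Constant vectors are fixed by each \<open>T\<^sub>k\<close>, because its rows sum to 1, and a common fixed point of
  the \<open>T\<^sub>k\<close> is fixed by their product.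
\<close>

section \<open>Linear recurrences with all roots in the open unit disc\<close>

text \<open>The polynomial \<open>p\<close> evaluated at the shift operator on sequences, applied to \<open>u\<close>.\<close>

definition shift_op :: "complex poly \<Rightarrow> (nat \<Rightarrow> complex) \<Rightarrow> nat \<Rightarrow> complex" where
  "shift_op p u n = (\<Sum>i\<le>degree p. coeff p i * u (n + i))"

lemma shift_op_eq_sum:
  assumes "\<And>i. i \<ge> N \<Longrightarrow> coeff p i = 0"
  shows "shift_op p u n = (\<Sum>i<N. coeff p i * u (n + i))"
  unfolding shift_op_def
proof (rule sum.mono_neutral_cong)
  fix i assume "i \<in> {..<N} - {..degree p}"
  then show "coeff p i * u (n + i) = 0" by (simp add: coeff_eq_0)
next
  fix i assume "i \<in> {..degree p} - {..<N}"
  then show "coeff p i * u (n + i) = 0" using assms by simp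
qed auto

lemma shift_op_linear_factor:
  "shift_op ([:- r, 1:] * g) u n = shift_op g u (Suc n) - r * shift_op g u n"
proof -
  let ?N = "Suc (degree g)"
  have c: "coeff ([:- r, 1:] * g) i = (case i of 0 \<Rightarrow> 0 | Suc j \<Rightarrow> coeff g j) - r * coeff g i" for i
    by (simp add: coeff_pCons split: nat.split)
  have "shift_op ([:- r, 1:] * g) u n = (\<Sum>i<Suc ?N. coeff ([:- r, 1:] * g) i * u (n + i))"
    by (rule shift_op_eq_sum) (auto simp: c coeff_eq_0 split: nat.split)
  also have "\<dots> = (\<Sum>i<Suc ?N. (case i of 0 \<Rightarrow> 0 | Suc j \<Rightarrow> coeff g j) * u (n + i))
                  - r * (\<Sum>i<Suc ?N. coeff g i * u (n + i))"
    by (simp only: c left_diff_distrib sum_subtractf sum_distrib_left mult.assoc)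
  also have "(\<Sum>i<Suc ?N. (case i of 0 \<Rightarrow> 0 | Suc j \<Rightarrow> coeff g j) * u (n + i))
      = (\<Sum>j<?N. coeff g j * u (Suc n + j))"
    by (subst sum.lessThan_Suc_shift) simp
  also have "\<dots> = shift_op g u (Suc n)"
    by (rule shift_op_eq_sum [symmetric]) (simp add: coeff_eq_0)
  also have "(\<Sum>i<Suc ?N. coeff g i * u (n + i)) = shift_op g u n"
    by (rule shift_op_eq_sum [symmetric]) (simp add: coeff_eq_0)
  finally show ?thesis .
qed

text \<open>Once the perturbations are at most \<open>\<epsilon> * (1 - norm r)\<close>, the excess of \<open>norm (v n)\<close> over \<open>\<epsilon>\<close>
  shrinks by the factor \<open>norm r\<close> in each step.\<close>

lemma perturbed_contraction_tendsto_0: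
  fixes v :: "nat \<Rightarrow> complex"
  assumes r: "norm r < 1" and d: "(\<lambda>n. v (Suc n) - r * v n) \<longlonglongrightarrow> 0"
  shows "v \<longlonglongrightarrow> 0"
proof (rule LIMSEQ_I)
  fix e :: real assume e: "e > 0"
  have "e / 2 * (1 - norm r) > 0" using e r by simp
  then obtain N where N: "\<And>n. n \<ge> N \<Longrightarrow> norm (v (Suc n) - r * v n) < e / 2 * (1 - norm r)"
    using LIMSEQ_D [OF d] by (metis diff_zero)
  have bd: "norm (v (N + k)) \<le> norm r ^ k * norm (v N) + e / 2" for k
  proof (induction k)
    case 0
    then show ?case using e by simp
  next
    case (Suc k)
    have "norm (v (Suc (N + k))) \<le> norm (r * v (N + k)) + norm (v (Suc (N + k)) - r * v (N + k))"
      by (rule norm_triangle_sub)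
    also have "\<dots> \<le> norm r * norm (v (N + k)) + e / 2 * (1 - norm r)"
      using N [of "N + k"] by (simp add: norm_mult)
    also have "\<dots> \<le> norm r * (norm r ^ k * norm (v N) + e / 2) + e / 2 * (1 - norm r)"
      using mult_left_mono [OF Suc.IH, of "norm r"] by simp
    also have "\<dots> = norm r ^ Suc k * norm (v N) + e / 2"
      by (simp add: field_simps)
    finally show ?case by simp
  qed
  have "(\<lambda>k. norm r ^ k * norm (v N)) \<longlonglongrightarrow> 0 * norm (v N)"
    by (intro tendsto_mult LIMSEQ_power_zero tendsto_const) (use r in simp)
  then have "(\<lambda>k. norm r ^ k * norm (v N)) \<longlonglongrightarrow> 0" by simp
  from LIMSEQ_D [OF this, of "e / 2"] obtain K where
    K: "\<And>k. k \<ge> K \<Longrightarrow> norm r ^ k * norm (v N) < e / 2"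
    using e by auto
  have "norm (v n) < e" if "n \<ge> N + K" for n
  proof -
    have "n - N \<ge> K" and "N + (n - N) = n" using that by auto
    then show ?thesis using bd [of "n - N"] K [of "n - N"] by simp
  qed
  then show "\<exists>no. \<forall>n\<ge>no. norm (v n - 0) < e" by auto
qed

text \<open>By the fundamental theorem of algebra, \<open>p = (x - r) * g\<close>. The sequence \<open>shift_op g u\<close> is then a
  perturbed contraction with ratio \<open>r\<close>, so the assumption on \<open>p\<close> passes to \<open>g\<close>.\<close>

lemma stable_recurrence_tendsto_0:
  assumes "p \<noteq> 0" and "\<And>z. poly p z = 0 \<Longrightarrow> norm z < 1" and "shift_op p u \<longlonglongrightarrow> 0"
  shows "u \<longlonglongrightarrow> 0"
  using assms
proof (induction "degree p" arbitrary: p)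
  case 0
  then obtain c where p: "p = [:c:]" by (metis degree_eq_zeroE)
  with 0 have c: "c \<noteq> 0" by simp
  have "(\<lambda>n. inverse c * shift_op p u n) \<longlonglongrightarrow> inverse c * 0"
    by (intro tendsto_mult tendsto_const 0)
  then show ?case using c by (simp add: p shift_op_def)
next
  case (Suc d)
  have "\<not> constant (poly p)" using Suc.hyps(2) by (simp add: constant_degree)
  then obtain r where r: "poly p r = 0" using fundamental_theorem_of_algebra by blast
  then obtain g where p: "p = [:- r, 1:] * g" by (metis dvdE poly_eq_0_iff_dvd)
  with Suc.prems(1) have g: "g \<noteq> 0" by auto
  have "degree p = Suc (degree g)"
    unfolding p using g by (subst degree_mult_eq) auto
  with Suc.hyps(2) have d: "d = degree g" by simp
  have "(\<lambda>n. shift_op g u (Suc n) - r * shift_op g u n) \<longlonglongrightarrow> 0"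
    using Suc.prems(3) by (simp only: p shift_op_linear_factor [abs_def])
  with Suc.prems(2) [OF r] have "shift_op g u \<longlonglongrightarrow> 0"
    by (rule perturbed_contraction_tendsto_0)
  moreover have "norm z < 1" if "poly g z = 0" for z
    using Suc.prems(2) [of z] that by (simp add: p)
  ultimately show ?case using Suc.hyps(1) [OF d g] by blast
qed

section \<open>Convergence of the solutions under the Basic Hypothesis\<close>

text \<open>With \<open>u k = z ^ k\<close> this is the factorization \<open>p(z) = (z - 1) q(z)\<close>; with \<open>u k = s (n + k)\<close> it shows
  that the \<open>a\<close>-weighted sum over a window of a solution does not change when the window moves.\<close>

lemma summation_by_parts_partial_sums:
  fixes b u :: "nat \<Rightarrow> 'a::comm_ring_1"
  shows "(\<Sum>k<m. (\<Sum>i\<le>k. b i) * (u (Suc k) - u k)) = (\<Sum>i<m. b i) * u m - (\<Sum>i<m. b i * u i)"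
  by (induction m) (simp_all add: lessThan_Suc_atMost [symmetric] algebra_simps)

definition solves_recurrence :: "nat \<Rightarrow> (nat \<Rightarrow> real) \<Rightarrow> (nat \<Rightarrow> real) \<Rightarrow> bool" where
  "solves_recurrence m \<alpha> s \<longleftrightarrow> (\<forall>n. s (n + m) = (\<Sum>i<m. \<alpha> i * s (n + i)))"

fun recurrence_solution :: "nat \<Rightarrow> (nat \<Rightarrow> real) \<Rightarrow> (nat \<Rightarrow> real) \<Rightarrow> nat \<Rightarrow> real" where
  "recurrence_solution m \<alpha> x n =
     (if n < m then x n else (\<Sum>i\<in>{..<m}. \<alpha> i * recurrence_solution m \<alpha> x (n - m + i)))"

declare recurrence_solution.simps [simp del]

lemma recurrence_solution_initial: "n < m \<Longrightarrow> recurrence_solution m \<alpha> x n = x n"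
  by (simp add: recurrence_solution.simps)

lemma solves_recurrence_solution: "solves_recurrence m \<alpha> (recurrence_solution m \<alpha> x)"
  unfolding solves_recurrence_def by (subst recurrence_solution.simps) simp

lemma weighted_window_invariant:
  assumes s: "solves_recurrence m \<alpha> s" and one: "(\<Sum>i<m. \<alpha> i) = 1"
  shows "(\<Sum>k<m. a_coeff \<alpha> k * s (n + k)) = (\<Sum>k<m. a_coeff \<alpha> k * s k)"
proof (induction n)
  case 0
  then show ?case by simp
next
  case (Suc n)
  have "(\<Sum>k<m. a_coeff \<alpha> k * s (Suc n + k)) - (\<Sum>k<m. a_coeff \<alpha> k * s (n + k))
      = (\<Sum>k<m. a_coeff \<alpha> k * (s (n + Suc k) - s (n + k)))"
    by (simp add: right_diff_distrib sum_subtractf)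
  also have "\<dots> = 0"
    using s one summation_by_parts_partial_sums [of \<alpha> "\<lambda>k. s (n + k)" m]
    by (simp add: a_coeff_def solves_recurrence_def)
  finally show ?case using Suc.IH by simp
qed

lemma poly_complex_char_p:
  "poly (map_poly complex_of_real (char_p m \<alpha>)) z = z ^ m - (\<Sum>i<m. of_real (\<alpha> i) * z ^ i)"
proof -
  have "map_poly complex_of_real (char_p m \<alpha>) = monom 1 m - (\<Sum>i<m. monom (of_real (\<alpha> i)) i)"
    by (rule poly_eqI) (auto simp: char_p_def coeff_map_poly coeff_sum intro!: sum.cong)
  then show ?thesis by (simp add: poly_sum poly_monom)
qed

lemma sum_a_coeff_pos:
  assumes "m > 0" and nn: "\<And>i. i < m \<Longrightarrow> \<alpha> i \<ge> 0" and one: "(\<Sum>i<m. \<alpha> i) = 1"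
  shows "(\<Sum>k<m. a_coeff \<alpha> k) > 0"
proof (rule sum_pos2)
  have "{..m - 1} = {..<m}" using assms(1) by auto
  then show "0 < a_coeff \<alpha> (m - 1)" by (simp add: a_coeff_def one)
qed (use assms in \<open>auto simp: a_coeff_def intro!: sum_nonneg\<close>)

text \<open>The deviation \<open>u\<close> of a solution from the claimed limit satisfies the recurrence with polynomial
  \<open>q\<close>, the factor of \<open>p\<close> that carries the roots other than 1.\<close>

lemma solution_converges:
  assumes m: "m > 0" and nn: "\<And>i. i < m \<Longrightarrow> \<alpha> i \<ge> 0" and one: "(\<Sum>i<m. \<alpha> i) = 1"
    and hyp: "basic_hypothesis m \<alpha>" and s: "solves_recurrence m \<alpha> s"
  shows "s \<longlonglongrightarrow> (\<Sum>k<m. a_coeff \<alpha> k * s k) / (\<Sum>k<m. a_coeff \<alpha> k)"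
proof -
  let ?A = "\<Sum>k<m. a_coeff \<alpha> k"
  define L where "L = (\<Sum>k<m. a_coeff \<alpha> k * s k) / ?A"
  define u where "u n = complex_of_real (s n - L)" for n
  define q where "q = (\<Sum>k<m. monom (complex_of_real (a_coeff \<alpha> k)) k)"
  have A: "?A > 0" by (rule sum_a_coeff_pos [OF m nn one])
  have coeff_q: "coeff q i = (if i < m then of_real (a_coeff \<alpha> i) else 0)" for i
    by (auto simp: q_def coeff_sum)
  have poly_q: "poly q z = (\<Sum>k<m. of_real (a_coeff \<alpha> k) * z ^ k)" for z
    by (simp add: q_def poly_sum poly_monom)
  have q1: "poly q 1 \<noteq> 0"
  proof -
    have "poly q 1 = of_real ?A" by (simp add: poly_q)
    then show ?thesis using A by (metis less_irrefl of_real_eq_0_iff)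
  qed
  have fact: "poly (map_poly complex_of_real (char_p m \<alpha>)) z = (z - 1) * poly q z" for z
  proof -
    have "(z - 1) * poly q z = (\<Sum>k<m. of_real (a_coeff \<alpha> k) * (z ^ Suc k - z ^ k))"
      by (simp add: poly_q sum_distrib_left algebra_simps)
    also have "\<dots> = (\<Sum>k<m. (\<Sum>i\<le>k. of_real (\<alpha> i)) * (z ^ Suc k - z ^ k))"
      by (simp add: a_coeff_def)
    also have "\<dots> = (\<Sum>i<m. of_real (\<alpha> i)) * z ^ m - (\<Sum>i<m. of_real (\<alpha> i) * z ^ i)"
      by (rule summation_by_parts_partial_sums)
    also have "(\<Sum>i<m. complex_of_real (\<alpha> i)) = 1"
      using one by (metis of_real_1 of_real_sum)
    finally show ?thesis by (simp add: poly_complex_char_p)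
  qed
  have roots: "norm z < 1" if "poly q z = 0" for z
    using that q1 hyp fact [of z] by (auto simp: basic_hypothesis_def)
  have "shift_op q u n = 0" for n
  proof -
    have "shift_op q u n = (\<Sum>k<m. coeff q k * u (n + k))"
      by (rule shift_op_eq_sum) (simp add: coeff_q)
    also have "\<dots> = of_real ((\<Sum>k<m. a_coeff \<alpha> k * s (n + k)) - ?A * L)"
      by (simp add: coeff_q u_def right_diff_distrib sum_subtractf sum_distrib_right)
    also have "\<dots> = 0"
      using A by (simp add: weighted_window_invariant [OF s one] L_def)
    finally show ?thesis .
  qed
  then have shift_q: "shift_op q u \<longlonglongrightarrow> 0" by (simp add: tendsto_eventually)
  have "q \<noteq> 0" using q1 by auto
  then have "u \<longlonglongrightarrow> 0" using roots shift_q by (rule stable_recurrence_tendsto_0)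
  then have "(\<lambda>n. s n - L) \<longlonglongrightarrow> 0"
    unfolding u_def by (metis of_real_0 tendsto_of_real_iff)
  then show ?thesis unfolding L_def [symmetric] by (simp add: LIM_zero_iff)
qed

section \<open>The matrices as updates of a window\<close>

lemma T_mat_carrier [simp]: "T_mat m \<alpha> k \<in> carrier_mat m m"
  by (simp add: T_mat_def)

lemma T_prod_carrier [simp]: "T_prod m \<alpha> k \<in> carrier_mat m m"
  by (induction k) (auto intro: mult_carrier_mat [OF T_mat_carrier])

lemma T_full_carrier [simp]: "T_full m \<alpha> \<in> carrier_mat m m"
  by (simp add: T_full_def)

lemma sum_lessThan_split:
  fixes f :: "nat \<Rightarrow> real"
  assumes "l + k = m"
  shows "(\<Sum>j<m. f j) = (\<Sum>j<l. f j) + (\<Sum>j<k. f (l + j))"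
  unfolding assms [symmetric] by (induction k) simp_all

text \<open>The only row that differs from the identity is \<open>\<alpha>\<close> rotated cyclically by \<open>k\<close> places; the two sums
  are the parts before and after the rotation wraps around.\<close>

lemma T_mat_mult_vec_index:
  assumes k: "k < m" and i: "i < m" and v: "v \<in> carrier_vec m"
  shows "(T_mat m \<alpha> (Suc k) *\<^sub>v v) $ i =
    (if i = k then (\<Sum>j<k. \<alpha> (m - k + j) * v $ j) + (\<Sum>j<m - k. \<alpha> j * v $ (k + j)) else v $ i)"
proof -
  have eq: "(T_mat m \<alpha> (Suc k) *\<^sub>v v) $ i = (\<Sum>j<m. T_entry m \<alpha> (Suc k) (Suc i) (Suc j) * v $ j)"
    using i v by (simp add: T_mat_def scalar_prod_def lessThan_atLeast0)
  show ?thesis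
  proof (cases "i = k")
    case False
    then have "(\<Sum>j<m. T_entry m \<alpha> (Suc k) (Suc i) (Suc j) * v $ j)
        = (\<Sum>j<m. if j = i then v $ j else 0)"
      by (intro sum.cong) (auto simp: T_entry_def)
    with False i show ?thesis by (simp add: eq)
  next
    case True
    let ?f = "\<lambda>j. T_entry m \<alpha> (Suc k) (Suc k) (Suc j) * v $ j"
    have "(\<Sum>j<m. ?f j) = (\<Sum>j<k. ?f j) + (\<Sum>j<m - k. ?f (k + j))"
      using k by (intro sum_lessThan_split) simp
    also have "(\<Sum>j<k. ?f j) = (\<Sum>j<k. \<alpha> (m - k + j) * v $ j)"
      using k by (intro sum.cong) (auto simp: T_entry_def Suc_diff_Suc)
    also have "(\<Sum>j<m - k. ?f (k + j)) = (\<Sum>j<m - k. \<alpha> j * v $ (k + j))"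
      by (intro sum.cong) (auto simp: T_entry_def)
    finally show ?thesis using eq unfolding True by simp
  qed
qed

definition window :: "nat \<Rightarrow> (nat \<Rightarrow> real) \<Rightarrow> nat \<Rightarrow> real vec" where
  "window m s n = vec m (\<lambda>i. s (n + i))"

lemma window_carrier [simp]: "window m s n \<in> carrier_vec m"
  by (simp add: window_def)

lemma T_prod_window:
  assumes s: "solves_recurrence m \<alpha> s" and "k \<le> m"
  shows "T_prod m \<alpha> k *\<^sub>v window m s n = vec m (\<lambda>i. if i < k then s (n + m + i) else s (n + i))"
  using assms(2)
proof (induction k)
  case 0
  then show ?case by (simp add: window_def)
next
  case (Suc k)
  let ?v = "vec m (\<lambda>i. if i < k then s (n + m + i) else s (n + i))"
  have km: "k < m" using Suc.prems by simp
  have "T_prod m \<alpha> (Suc k) *\<^sub>v window m s n = T_mat m \<alpha> (Suc k) *\<^sub>v ?v"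
    using Suc by (simp add: assoc_mult_mat_vec [of _ m m _ m])
  also have "\<dots> = vec m (\<lambda>i. if i < Suc k then s (n + m + i) else s (n + i))"
  proof (rule eq_vecI)
    fix i assume "i < dim_vec (vec m (\<lambda>i. if i < Suc k then s (n + m + i) else s (n + i)))"
    then have i: "i < m" by simp
    \<comment> \<open>The first \<open>k\<close> entries of \<open>?v\<close> are already advanced by \<open>m\<close>, so \<open>?v\<close> is a rotated window of the
        terms from \<open>n + k\<close> on. The rotation of the matrix row matches it.\<close>
    have "s (n + k + m) = (\<Sum>j<m. \<alpha> j * s (n + k + j))"
      using s by (simp add: solves_recurrence_def)
    also have "\<dots> = (\<Sum>j<m - k. \<alpha> j * s (n + k + j)) + (\<Sum>j<k. \<alpha> (m - k + j) * s (n + m + j))"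
      using km by (subst sum_lessThan_split [of "m - k" k m]) (simp_all add: ac_simps)
    finally show "(T_mat m \<alpha> (Suc k) *\<^sub>v ?v) $ i
        = vec m (\<lambda>i. if i < Suc k then s (n + m + i) else s (n + i)) $ i"
      using i km by (auto simp: T_mat_mult_vec_index ac_simps intro!: arg_cong2 [of _ _ _ _ "(+)"] sum.cong)
  qed (simp add: T_mat_def)
  finally show ?case .
qed

lemma T_full_power_window:
  assumes s: "solves_recurrence m \<alpha> s"
  shows "(T_full m \<alpha> ^\<^sub>m r) *\<^sub>v window m s n = window m s (n + r * m)"
proof (induction r arbitrary: n)
  case 0
  then show ?case by (simp add: carrier_matD(1) [OF T_full_carrier])
next
  case (Suc r)
  have "T_full m \<alpha> *\<^sub>v window m s n = window m s (n + m)"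
    unfolding T_full_def T_prod_window [OF s order_refl] by (auto simp: window_def)
  then show ?case
    by (simp add: Suc.IH add.assoc
        assoc_mult_mat_vec [OF pow_carrier_mat [OF T_full_carrier] T_full_carrier window_carrier])
qed

section \<open>The limit and the fixed points\<close>

text \<open>Every vector is the initial window of a solution, so the powers move it along that solution.\<close>

lemma T_full_power_mult_vec_tendsto:
  assumes "m > 0" and "\<And>i. i < m \<Longrightarrow> \<alpha> i \<ge> 0" and "(\<Sum>i<m. \<alpha> i) = 1"
    and "basic_hypothesis m \<alpha>" and x: "x \<in> carrier_vec m" and i: "i < m"
  shows "(\<lambda>n. ((T_full m \<alpha> ^\<^sub>m n) *\<^sub>v x) $ i)
    \<longlonglongrightarrow> (\<Sum>k<m. a_coeff \<alpha> k * x $ k) / (\<Sum>k<m. a_coeff \<alpha> k)"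
proof -
  define s where "s = recurrence_solution m \<alpha> (\<lambda>k. x $ k)"
  have s: "solves_recurrence m \<alpha> s"
    unfolding s_def by (rule solves_recurrence_solution)
  have init: "s k = x $ k" if "k < m" for k
    using that by (simp add: s_def recurrence_solution_initial)
  have x_eq: "x = window m s 0"
    using x init by (auto simp: window_def)
  have "filterlim (\<lambda>n. n * m + i) sequentially sequentially"
  proof (rule filterlim_at_top_mono)
    show "eventually (\<lambda>n. n \<le> n * m + i) sequentially"
      using assms(1) by (auto simp: trans_le_add1)
  qed (rule filterlim_ident)
  with solution_converges [OF assms(1-4) s]
  have "(\<lambda>n. s (n * m + i)) \<longlonglongrightarrow> (\<Sum>k<m. a_coeff \<alpha> k * s k) / (\<Sum>k<m. a_coeff \<alpha> k)"
    by (rule filterlim_compose)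
  moreover have "((T_full m \<alpha> ^\<^sub>m n) *\<^sub>v x) $ i = s (n * m + i)" for n
    unfolding x_eq T_full_power_window [OF s] using i by (simp add: window_def)
  ultimately show ?thesis by (simp add: init)
qed

lemma diagonal_subset_Fix_T_mat:
  assumes one: "(\<Sum>i<m. \<alpha> i) = 1" and k: "k \<in> {1..m}"
  shows "diagonal m \<subseteq> Fix m (T_mat m \<alpha> k)"
proof
  fix x assume "x \<in> diagonal m"
  then obtain c where x: "x = vec m (\<lambda>_. c)" by (auto simp: diagonal_def)
  obtain l where l: "k = Suc l" "l < m" using k by (cases k) auto
  have rot: "(\<Sum>j<l. \<alpha> (m - l + j)) + (\<Sum>j<m - l. \<alpha> j) = 1"
    using l(2) sum_lessThan_split [of "m - l" l m \<alpha>] unfolding one by linarith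
  have row: "(\<Sum>j<l. \<alpha> (m - l + j) * c) + (\<Sum>j<m - l. \<alpha> j * c) = c"
    unfolding sum_distrib_right [symmetric] distrib_right [symmetric] rot by simp
  have "T_mat m \<alpha> k *\<^sub>v x = x"
    unfolding l(1)
  proof (rule eq_vecI)
    fix i assume "i < dim_vec x"
    then show "(T_mat m \<alpha> (Suc l) *\<^sub>v x) $ i = x $ i"
      using l(2) row by (auto simp: x T_mat_mult_vec_index)
  qed (simp add: x T_mat_def)
  then show "x \<in> Fix m (T_mat m \<alpha> k)" by (simp add: Fix_def x)
qed

text \<open>The intersection with \<^term>\<open>carrier_vec m\<close> matters for \<open>m = 0\<close>, where the indexed intersection is
  the universe.\<close>

lemma Inter_Fix_T_mat_subset_Fix_T_full:
  "(\<Inter>k\<in>{1..m}. Fix m (T_mat m \<alpha> k)) \<inter> carrier_vec m \<subseteq> Fix m (T_full m \<alpha>)"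
proof
  fix x assume x: "x \<in> (\<Inter>k\<in>{1..m}. Fix m (T_mat m \<alpha> k)) \<inter> carrier_vec m"
  have "T_prod m \<alpha> k *\<^sub>v x = x" if "k \<le> m" for k
    using that
  proof (induction k)
    case (Suc k)
    then have "T_mat m \<alpha> (Suc k) *\<^sub>v x = x" using x by (auto simp: Fix_def)
    with Suc x show ?case by (simp add: assoc_mult_mat_vec [of _ m m _ m])
  qed (use x in simp)
  with x show "x \<in> Fix m (T_full m \<alpha>)" by (simp add: Fix_def T_full_def)
qed

lemma pow_mat_mult_vec_fixed:
  assumes "A \<in> carrier_mat m m" and "x \<in> carrier_vec m" and "A *\<^sub>v x = x"
  shows "(A ^\<^sub>m n) *\<^sub>v x = x"
  using assms
  by (induction n) (simp_all add: assoc_mult_mat_vec [OF pow_carrier_mat])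

lemma Fix_T_full_subset_diagonal:
  assumes "m > 0" and "\<And>i. i < m \<Longrightarrow> \<alpha> i \<ge> 0" and "(\<Sum>i<m. \<alpha> i) = 1"
    and "basic_hypothesis m \<alpha>"
  shows "Fix m (T_full m \<alpha>) \<subseteq> diagonal m"
proof
  fix x assume "x \<in> Fix m (T_full m \<alpha>)"
  then have x: "x \<in> carrier_vec m" and fixed: "T_full m \<alpha> *\<^sub>v x = x"
    by (auto simp: Fix_def)
  define L where "L = (\<Sum>k<m. a_coeff \<alpha> k * x $ k) / (\<Sum>k<m. a_coeff \<alpha> k)"
  have "x $ i = L" if "i < m" for i
    using T_full_power_mult_vec_tendsto [OF assms x that]
    by (simp add: pow_mat_mult_vec_fixed [OF T_full_carrier x fixed] L_def LIMSEQ_const_iff)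
  then have "x = vec m (\<lambda>_. L)" using x by auto
  then show "x \<in> diagonal m" by (auto simp: diagonal_def)
qed

lemma outer_prod_eq_mat: "outer_prod v w = mat (dim_vec v) (dim_vec w) (\<lambda>(i, j). v $ i * w $ j)"
  by (rule eq_matI) (auto simp: outer_prod_def scalar_prod_def mat_of_cols_def mat_of_rows_def)

theorem theorem3p3:
  fixes m :: nat and \<alpha> :: "nat \<Rightarrow> real"
  assumes "m \<ge> 2"
    and "\<And>i. i < m \<Longrightarrow> \<alpha> i \<ge> 0"
    and "(\<Sum>i<m. \<alpha> i) = 1"
    and "basic_hypothesis m \<alpha>"
  shows "mat_tendsto (\<lambda>n. T_full m \<alpha> ^\<^sub>m n)
           ((1 / (a_vec m \<alpha> \<bullet> e_vec m)) \<cdot>\<^sub>m outer_prod (e_vec m) (a_vec m \<alpha>)) \<and>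
    (1 / (a_vec m \<alpha> \<bullet> e_vec m)) \<cdot>\<^sub>m outer_prod (e_vec m) (a_vec m \<alpha>)
           = outer_prod (e_vec m) (lambda_vec m \<alpha>) \<and>
    outer_prod (e_vec m) (lambda_vec m \<alpha>)
           = mat m m (\<lambda>(i, j). 1 / (\<Sum>k<m. \<Sum>l\<le>k. \<alpha> l) *
               (if j = m - 1 then 1 else \<Sum>l\<le>j. \<alpha> l)) \<and>
    Fix m (T_full m \<alpha>) = diagonal m \<and>
    diagonal m = (\<Inter>k\<in>{1..m}. Fix m (T_mat m \<alpha> k))"
proof -
  have m: "m > 0" using assms(1) by simp
  let ?A = "\<Sum>k<m. a_coeff \<alpha> k"
  let ?E = "mat m m (\<lambda>(i, j). a_coeff \<alpha> j / ?A)"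
  have limit_a: "(1 / (a_vec m \<alpha> \<bullet> e_vec m)) \<cdot>\<^sub>m outer_prod (e_vec m) (a_vec m \<alpha>) = ?E"
    by (rule eq_matI) (auto simp: outer_prod_eq_mat a_vec_def e_vec_def scalar_prod_def lessThan_atLeast0)
  have limit_lambda: "outer_prod (e_vec m) (lambda_vec m \<alpha>) = ?E"
    by (rule eq_matI) (auto simp: outer_prod_eq_mat lambda_vec_def e_vec_def)
  have "{..m - 1} = {..<m}" using m by auto
  then have last: "(\<Sum>l\<le>m - 1. \<alpha> l) = 1" using assms(3) by simp
  have limit_rows: "?E = mat m m (\<lambda>(i, j). 1 / (\<Sum>k<m. \<Sum>l\<le>k. \<alpha> l) *
               (if j = m - 1 then 1 else \<Sum>l\<le>j. \<alpha> l))"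
    using last by (intro eq_matI) (auto simp: a_coeff_def)
  have "(\<lambda>n. (T_full m \<alpha> ^\<^sub>m n) $$ (i, j)) \<longlonglongrightarrow> ?E $$ (i, j)" if i: "i < m" and j: "j < m" for i j
  proof -
    \<comment> \<open>Column \<open>j\<close> of the power is its value at the \<open>j\<close>-th unit vector.\<close>
    have "((T_full m \<alpha> ^\<^sub>m n) *\<^sub>v unit_vec m j) $ i = (T_full m \<alpha> ^\<^sub>m n) $$ (i, j)" for n
      using i j carrier_matD [OF pow_carrier_mat [OF T_full_carrier [of m \<alpha>], of n]]
      by simp
    moreover have "(\<Sum>k<m. a_coeff \<alpha> k * unit_vec m j $ k) = a_coeff \<alpha> j"
    proof -
      have "(\<Sum>k<m. a_coeff \<alpha> k * unit_vec m j $ k) = (\<Sum>k<m. if k = j then a_coeff \<alpha> k else 0)"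
        using j by (intro sum.cong) auto
      with j show ?thesis by simp
    qed
    ultimately show ?thesis
      using T_full_power_mult_vec_tendsto [OF m assms(2-4) unit_vec_carrier i, of j] i j by simp
  qed
  then have tends: "mat_tendsto (\<lambda>n. T_full m \<alpha> ^\<^sub>m n) ?E"
    using pow_carrier_mat [OF T_full_carrier [of m \<alpha>]] by (auto simp: mat_tendsto_def)
  have "Fix m (T_full m \<alpha>) \<subseteq> diagonal m"
    by (rule Fix_T_full_subset_diagonal [OF m assms(2-4)])
  moreover have "diagonal m \<subseteq> (\<Inter>k\<in>{1..m}. Fix m (T_mat m \<alpha> k))"
    using diagonal_subset_Fix_T_mat [OF assms(3)] by blast
  moreover have "(\<Inter>k\<in>{1..m}. Fix m (T_mat m \<alpha> k)) \<subseteq> Fix m (T_full m \<alpha>)"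
    using Inter_Fix_T_mat_subset_Fix_T_full [of m \<alpha>] m by (fastforce simp: Fix_def)
  ultimately show ?thesis
    unfolding limit_a limit_lambda using tends limit_rows by blast
qed

end
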